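(* Let $F:\mathbb{R}^d\multimap\mathbb{R}^d$ be a cyclically quasi-monotone multi-map. If the pre-order $\preceq_F$ is total, then it is a quasi-convex and lower semi-continuous preference relation, and there exists a lower semi-continuous quasi-convex function $f:\mathbb{R}^d\to\mathbb{R}$ such that $F(x)\subseteq \mathrm{N}f(x)$ for every $x\in\mathbb{R}^d$.
   Context: A multi-map $F:\mathbb{R}^d\multimap\mathbb{R}^d$ is a map from $\mathbb{R}^d$ to $2^{\mathbb{R}^d}$; it has full domain if $F(x)\ne\emptyset$ for every $x$ (always assumed). A multi-map $F$ with full domain is cyclically quasi-monotone if for every integer $N\ge1$, every $x_0,\dots,x_N\in\mathbb{R}^d$ with $x_N=x_0$ and every $p_i\in F(x_i)$ ($0\le i<N$), one has $\min_{0\le i<N}(x_{i+1}-x_i)\cdot p_i\le0$. Define $x\prec_F y$ iff there are an integer $N\ge1$, points $x_0,\dots,x_N\in\mathbb{R}^d$ with $x_0=x$, $x_N=y$, and $p_i\in F(x_i)$ with $(x_{i+1}-x_i)\cdot p_i>0$ for all $0\le i<N$. Define $x\preceq_F y$ iff for all $w\in\mathbb{R}^d$, $w\prec_F x\implies w\prec_F y$. A pre-order is a reflexive and transitive relation; a relation $\preceq$ is total if for all $x,y$ at least one of $x\preceq y$, $y\preceq x$ holds; a preference relation is a total pre-order. A pre-order $\preceq$ on $\mathbb{R}^d$ is lower semi-continuous (resp. quasi-convex) if $\{w:w\preceq x\}$ is closed (resp. convex) for every $x$. A function $f:\mathbb{R}^d\to\mathbb{R}$ is quasi-convex if $\{f\le\ell\}$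 is convex for every $\ell\in\mathbb{R}$; its normal cone multi-map is $\mathrm{N}f(x)=\{p\in\mathbb{R}^d:\forall w,\ f(w)\le f(x)\implies p\cdot(w-x)\le0\}$. *)

theory Defs
  imports "HOL-Analysis.Analysis"
begin

type_synonym 'a multimap = "'a \<Rightarrow> 'a set"

definition full_domain :: "'a multimap \<Rightarrow> bool" where
  "full_domain F \<longleftrightarrow> (\<forall>x. F x \<noteq> {})"

text \<open>Finite families are the initial segments of sequences: only the points \<open>x 0, \<dots>, x N\<close> and
  the vectors \<open>p 0, \<dots>, p (N - 1)\<close> matter.\<close>

definition cyclically_quasi_monotone :: "'a::real_inner multimap \<Rightarrow> bool" where
  "cyclically_quasi_monotone F \<longleftrightarrow>
     (\<forall>N x p. N \<ge> 1 \<and> x N = x 0 \<and> (\<forall>i<N. p i \<in> F (x i)) \<longrightarrow>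
        (MIN i\<in>{..<N}. (x (Suc i) - x i) \<bullet> p i) \<le> (0::real))"

definition strict_rel :: "'a::real_inner multimap \<Rightarrow> 'a \<Rightarrow> 'a \<Rightarrow> bool" where
  "strict_rel F y z \<longleftrightarrow>
     (\<exists>N x p. N \<ge> 1 \<and> x 0 = y \<and> x N = z \<and>
        (\<forall>i<N. p i \<in> F (x i) \<and> (x (Suc i) - x i) \<bullet> p i > (0::real)))"

definition weak_rel :: "'a::real_inner multimap \<Rightarrow> 'a \<Rightarrow> 'a \<Rightarrow> bool" where
  "weak_rel F x y \<longleftrightarrow> (\<forall>w. strict_rel F w x \<longrightarrow> strict_rel F w y)"

definition preorder_rel :: "('a \<Rightarrow> 'a \<Rightarrow> bool) \<Rightarrow> bool" where
  "preorder_rel R \<longleftrightarrow> reflp R \<and> transp R"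

text \<open>Unlike \<open>totalp\<close>, this does not exempt the case \<open>x = y\<close>.\<close>

definition total_rel :: "('a \<Rightarrow> 'a \<Rightarrow> bool) \<Rightarrow> bool" where
  "total_rel R \<longleftrightarrow> (\<forall>x y. R x y \<or> R y x)"

definition preference_rel :: "('a \<Rightarrow> 'a \<Rightarrow> bool) \<Rightarrow> bool" where
  "preference_rel R \<longleftrightarrow> total_rel R \<and> preorder_rel R"

definition lower_semicontinuous_rel :: "('a::topological_space \<Rightarrow> 'a \<Rightarrow> bool) \<Rightarrow> bool" where
  "lower_semicontinuous_rel R \<longleftrightarrow> (\<forall>x. closed {w. R w x})"

definition quasi_convex_rel :: "('a::real_vector \<Rightarrow> 'a \<Rightarrow> bool) \<Rightarrow> bool" where
  "quasi_convex_rel R \<longleftrightarrow> (\<forall>x. convex {w. R w x})"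

definition quasi_convex :: "('a::real_vector \<Rightarrow> real) \<Rightarrow> bool" where
  "quasi_convex f \<longleftrightarrow> (\<forall>l. convex {x. f x \<le> l})"

text \<open>The limit inferior is taken in the extended reals, where it always exists.\<close>

definition lower_semicontinuous :: "('a::topological_space \<Rightarrow> real) \<Rightarrow> bool" where
  "lower_semicontinuous f \<longleftrightarrow> (\<forall>x. ereal (f x) \<le> Liminf (at x) (\<lambda>y. ereal (f y)))"

definition normal_cone :: "('a::real_inner \<Rightarrow> real) \<Rightarrow> 'a multimap" where
  "normal_cone f x = {p. \<forall>w. f w \<le> f x \<longrightarrow> p \<bullet> (w - x) \<le> 0}"

lemma lower_semicontinuous_iff_closed_sublevel:
  "lower_semicontinuous f \<longleftrightarrow> (\<forall>l. closed {x. f x \<le> l})"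
proof -
  have pw: "ereal (f x) \<le> Liminf (at x) (\<lambda>y. ereal (f y)) \<longleftrightarrow>
      (\<forall>l < f x. eventually (\<lambda>y. l < f y) (nhds x))" for x
  proof
    assume A: "ereal (f x) \<le> Liminf (at x) (\<lambda>y. ereal (f y))"
    show "\<forall>l < f x. eventually (\<lambda>y. l < f y) (nhds x)"
    proof (intro allI impI)
      fix l assume l: "l < f x"
      then have "eventually (\<lambda>y. ereal l < ereal (f y)) (at x)"
        using A unfolding le_Liminf_iff by (metis less_ereal.simps(1))
      then show "eventually (\<lambda>y. l < f y) (nhds x)"
        using l by (auto simp: eventually_at_filter elim!: eventually_mono)
    qed
  next
    assume A: "\<forall>l < f x. eventually (\<lambda>y. l < f y) (nhds x)"
    show "ereal (f x) \<le> Liminf (at x) (\<lambda>y. ereal (f y))"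
      unfolding le_Liminf_iff
    proof (intro allI impI)
      fix c assume c: "c < ereal (f x)"
      show "eventually (\<lambda>y. c < ereal (f y)) (at x)"
      proof (cases c)
        case (real r)
        then have "eventually (\<lambda>y. r < f y) (nhds x)" using A c by auto
        then show ?thesis using real by (auto simp: eventually_at_filter elim!: eventually_mono)
      qed (use c in auto)
    qed
  qed
  have cl: "closed {x. f x \<le> l} \<longleftrightarrow> open {x. l < f x}" for l
    by (simp add: closed_def Compl_eq not_le)
  have op: "open {x. l < f x} \<longleftrightarrow> (\<forall>x. l < f x \<longrightarrow> eventually (\<lambda>y. l < f y) (nhds x))" for l
    by (auto simp: open_subopen[of "{x. l < f x}"] eventually_nhds subset_eq)
  show ?thesis
    unfolding lower_semicontinuous_def pw cl op by auto
qed

end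

theory Submission
  imports Defs
begin

text \<open>The strict up-sets \<open>{w. u \<prec> w}\<close> are unions of open half-spaces, since the last step of a chain
  only tests its endpoint against a half-space; hence each \<open>{w. w \<preceq> x}\<close>, an intersection of
  complements of such sets, is closed and convex. For the utility function, take a countable basis
  \<open>B n\<close> and let \<open>D n\<close> be the closure of the union of all lower sets \<open>{w. w \<preceq> z}\<close> disjoint from \<open>B n\<close>.
  The closed convex sets \<open>D n\<close> form a chain that separates strictly ordered points, and
  \<open>f x = (\<Sum>n. 2\<^sup>-\<^sup>n [x \<notin> D n])\<close> does the job.\<close>

text \<open>Cut off or append the last link of a chain. The alternative \<open>z = u\<close> covers
  chains of a single link, because \<open>strict_rel\<close> admits no empty chain.\<close>

lemma strict_rel_last_step:
  "strict_rel F u w \<longleftrightarrow> (\<exists>z p. (z = u \<or> strict_rel F u z) \<and> p \<in> F z \<and> (w - z) \<bullet> p > 0)"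
    (is "_ \<longleftrightarrow> ?R")
proof
  assume "strict_rel F u w"
  then obtain N x p where N: "N \<ge> 1" "x 0 = u" "x N = w"
    and st: "\<forall>i<N. p i \<in> F (x i) \<and> (x (Suc i) - x i) \<bullet> p i > 0"
    unfolding strict_rel_def by blast
  then obtain M where M: "N = Suc M" by (cases N) auto
  have "x M = u \<or> strict_rel F u (x M)"
  proof (cases "M = 0")
    case False
    then have "strict_rel F u (x M)"
      unfolding strict_rel_def using N st M by (intro exI[of _ M] exI[of _ x] exI[of _ p]) auto
    then show ?thesis ..
  qed (use N in auto)
  then show ?R using st M N by auto
next
  assume ?R
  then obtain z q where z: "z = u \<or> strict_rel F u z" and q: "q \<in> F z" "(w - z) \<bullet> q > 0"
    by blast
  \<comment> \<open>Length 0 is allowed here, so that \<open>z = u\<close> becomes the empty chain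
    and appending one link settles both cases.\<close>
  have "\<exists>N x p. x 0 = u \<and> x N = z \<and> (\<forall>i<N. p i \<in> F (x i) \<and> (x (Suc i) - x i) \<bullet> p i > 0)"
    using z
  proof
    assume "z = u"
    then show ?thesis by (intro exI[of _ 0] exI[of _ "\<lambda>_. u"]) auto
  qed (auto simp: strict_rel_def)
  then obtain N x p where "x 0 = u" "x N = z"
    "\<forall>i<N. p i \<in> F (x i) \<and> (x (Suc i) - x i) \<bullet> p i > 0" by blast
  then show "strict_rel F u w"
    unfolding strict_rel_def using q
    by (intro exI[of _ "Suc N"] exI[of _ "x(Suc N := w)"] exI[of _ "p(N := q)"])
       (auto simp: less_Suc_eq)
qed

lemma
  fixes F :: "'a::real_inner multimap"
  shows closed_not_strict_rel: "closed {w. \<not> strict_rel F u w}" (is ?closed)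
    and convex_not_strict_rel: "convex {w. \<not> strict_rel F u w}" (is ?convex)
proof -
  have step: "(w - z) \<bullet> p > 0 \<longleftrightarrow> \<not> p \<bullet> w \<le> p \<bullet> z" for w z p :: 'a
    by (simp add: inner_commute[of "w - z" p] inner_diff_right not_le)
  have eq: "{w. \<not> strict_rel F u w} =
      (\<Inter>(z, p) \<in> {(z, p). (z = u \<or> strict_rel F u z) \<and> p \<in> F z}. {w. p \<bullet> w \<le> p \<bullet> z})"
    by (subst strict_rel_last_step) (use step in blast)
  show ?closed unfolding eq by (intro closed_INT) (auto simp: closed_halfspace_le)
  show ?convex unfolding eq by (intro convex_INT) (auto simp: convex_halfspace_le)
qed

lemma weak_rel_lower_set:
  "{w. weak_rel F w x} = (\<Inter>u \<in> {u. \<not> strict_rel F u x}. {w. \<not> strict_rel F u w})"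
  unfolding weak_rel_def by auto

lemma lower_semicontinuous_weak_rel: "lower_semicontinuous_rel (weak_rel F)"
  unfolding lower_semicontinuous_rel_def weak_rel_lower_set
  by (intro allI closed_INT ballI closed_not_strict_rel)

lemma quasi_convex_weak_rel: "quasi_convex_rel (weak_rel F)"
  unfolding quasi_convex_rel_def weak_rel_lower_set
  by (intro allI convex_INT convex_not_strict_rel)

lemma preorder_weak_rel: "preorder_rel (weak_rel F)"
  unfolding preorder_rel_def weak_rel_def by (auto intro: reflpI transpI)

text \<open>A chain from \<open>x\<close> to itself is a cycle whose increments are all positive.
  Their minimum, over a nonempty finite index set, is then positive too.\<close>

lemma strict_rel_irrefl:
  assumes "cyclically_quasi_monotone F"
  shows "\<not> strict_rel F x x"
proof
  assume "strict_rel F x x"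
  then obtain N y p where y: "N \<ge> 1" "y N = y 0"
    and st: "\<forall>i<N. p i \<in> F (y i) \<and> (y (Suc i) - y i) \<bullet> p i > 0"
    unfolding strict_rel_def by auto
  then have "(MIN i\<in>{..<N}. (y (Suc i) - y i) \<bullet> p i) \<le> 0"
    using assms unfolding cyclically_quasi_monotone_def by blast
  moreover have "(MIN i\<in>{..<N}. (y (Suc i) - y i) \<bullet> p i) > 0"
    using y st by (subst Min_gr_iff) (auto simp: lessThan_empty_iff)
  ultimately show False by simp
qed

lemma summable_half_power_of_bool: "summable (\<lambda>n. (1/2) ^ n * of_bool (P n) :: real)"
  by (rule summable_comparison_test'[OF summable_geometric[of "1/2 :: real"]]) auto

lemma suminf_half_power_of_bool_mono:
  assumes "\<And>n. P n \<Longrightarrow> Q n"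
  shows "(\<Sum>n. (1/2) ^ n * of_bool (P n) :: real) \<le> (\<Sum>n. (1/2) ^ n * of_bool (Q n))"
  using assms by (intro suminf_le summable_half_power_of_bool) auto

lemma suminf_half_power_of_bool_strict_mono:
  assumes "\<And>n. P n \<Longrightarrow> Q n" and "Q k" "\<not> P k"
  shows "(\<Sum>n. (1/2) ^ n * of_bool (P n) :: real) < (\<Sum>n. (1/2) ^ n * of_bool (Q n))"
proof -
  have "0 < (\<Sum>n. (1/2) ^ n * of_bool (Q n) - (1/2) ^ n * of_bool (P n) :: real)"
    using assms by (intro suminf_pos2[where i = k] summable_diff summable_half_power_of_bool) auto
  then show ?thesis
    by (simp add: suminf_diff[OF summable_half_power_of_bool summable_half_power_of_bool, symmetric])
qed

text \<open>If the sum at \<open>x\<close> exceeds \<open>l\<close>, some partial sum already does.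
  It involves finitely many sets \<open>D n\<close>, so every point near \<open>x\<close> avoids
  those that \<open>x\<close> avoids and keeps at least this partial sum.\<close>

lemma lower_semicontinuous_suminf_closed:
  fixes D :: "nat \<Rightarrow> 'a::topological_space set"
  assumes "\<And>n. closed (D n)"
  shows "lower_semicontinuous (\<lambda>x. \<Sum>n. (1/2) ^ n * of_bool (x \<notin> D n))"
    (is "lower_semicontinuous ?f")
  unfolding lower_semicontinuous_iff_closed_sublevel
proof
  fix l
  have "open {x. l < ?f x}"
  proof (subst open_subopen, safe)
    fix x assume "l < ?f x"
    then obtain N where N: "l < (\<Sum>n<N. (1/2) ^ n * of_bool (x \<notin> D n))"
      using suminf_le_const[OF summable_half_power_of_bool, of "\<lambda>n. x \<notin> D n" l]
      by (meson not_le)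
    let ?U = "\<Inter>n \<in> {n. n < N \<and> x \<notin> D n}. - D n"
    have "open ?U" using assms by (intro open_INT) auto
    moreover have "l < ?f y" if "y \<in> ?U" for y
    proof -
      note N
      also have "(\<Sum>n<N. (1/2) ^ n * of_bool (x \<notin> D n)) \<le> (\<Sum>n<N. (1/2) ^ n * of_bool (y \<notin> D n) :: real)"
        using that by (intro sum_mono) auto
      also have "\<dots> \<le> ?f y"
        by (intro sum_le_suminf summable_half_power_of_bool) auto
      finally show ?thesis .
    qed
    ultimately show "\<exists>T. open T \<and> x \<in> T \<and> T \<subseteq> {x. l < ?f x}"
      by (intro exI[of _ ?U]) auto
  qed
  then show "closed {x. ?f x \<le> l}" by (simp add: closed_def Compl_eq not_le)
qed

text \<open>Along a chain, one of the two endpoints lies in every \<open>D n\<close> that contains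
  the other. By convexity the whole segment stays in those sets, so the sum on it is bounded by the
  larger endpoint value.\<close>

lemma quasi_convex_suminf_chain:
  fixes D :: "nat \<Rightarrow> 'a::real_vector set"
  assumes "\<And>n. convex (D n)" and "\<And>m n. D m \<subseteq> D n \<or> D n \<subseteq> D m"
  shows "quasi_convex (\<lambda>x. \<Sum>n. (1/2) ^ n * of_bool (x \<notin> D n))" (is "quasi_convex ?f")
  unfolding quasi_convex_def
proof (intro allI convexI; clarify)
  fix l x y and u v :: real
  assume l: "?f x \<le> l" "?f y \<le> l" and uv: "0 \<le> u" "0 \<le> v" "u + v = 1"
  let ?z = "u *\<^sub>R x + v *\<^sub>R y"
  have z: "?z \<in> D n" if "x \<in> D n" "y \<in> D n" for n
    using convexD[OF assms(1) that uv] .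
  have "(\<forall>n. x \<in> D n \<longrightarrow> y \<in> D n) \<or> (\<forall>n. y \<in> D n \<longrightarrow> x \<in> D n)"
    using assms(2) by blast
  then have "(\<forall>n. ?z \<notin> D n \<longrightarrow> x \<notin> D n) \<or> (\<forall>n. ?z \<notin> D n \<longrightarrow> y \<notin> D n)"
    using z by blast
  then have "?f ?z \<le> ?f x \<or> ?f ?z \<le> ?f y"
    using suminf_half_power_of_bool_mono by metis
  then show "?f ?z \<le> l" using l by linarith
qed

text \<open>By totality one of the two points dominates both, and its lower set is convex and
  contained in \<open>C\<close>.\<close>

lemma convex_lower_set:
  fixes R :: "'a::real_vector \<Rightarrow> 'a \<Rightarrow> bool"
  assumes "total_rel R" "quasi_convex_rel R" and C: "\<And>v w. w \<in> C \<Longrightarrow> R v w \<Longrightarrow> v \<in> C"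
  shows "convex C"
proof (rule convexI)
  fix x y and u v :: real
  assume xy: "x \<in> C" "y \<in> C" and uv: "0 \<le> u" "0 \<le> v" "u + v = 1"
  obtain m where m: "m \<in> C" "R x m" "R y m"
    using xy assms(1) unfolding total_rel_def by metis
  then have "R (u *\<^sub>R x + v *\<^sub>R y) m"
    using convexD[of "{w. R w m}" x y u v] assms(2) uv unfolding quasi_convex_rel_def by auto
  then show "u *\<^sub>R x + v *\<^sub>R y \<in> C" using C m by blast
qed

text \<open>The conclusion is one-sided: equivalent points may receive different values, since
  taking the closure of \<open>C n\<close> can destroy its being a lower set. Contraposed, it says
  that \<open>f y \<le> f x\<close> implies \<open>R y x\<close>.\<close>

lemma quasi_convex_lower_semicontinuous_utility:
  fixes R :: "'a::{real_normed_vector, second_countable_topology} \<Rightarrow> 'a \<Rightarrow> bool"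
  assumes "preference_rel R" and qc: "quasi_convex_rel R" and lsc: "lower_semicontinuous_rel R"
  obtains f where "lower_semicontinuous f" "quasi_convex f" "\<And>x y. \<not> R y x \<Longrightarrow> f x < f y"
proof -
  have tot: "total_rel R" and total: "R x y \<or> R y x" and trans: "R x y \<Longrightarrow> R y z \<Longrightarrow> R x z" for x y z
    using assms(1) unfolding preference_rel_def preorder_rel_def total_rel_def
    by (auto dest: transpD)
  obtain \<B> :: "'a set set" where \<B>: "countable \<B>" "topological_basis \<B>"
    using ex_countable_basis by blast
  have "\<B> \<noteq> {}" using topological_basisE[OF \<B>(2) open_UNIV UNIV_I] by blast
  define B where "B = from_nat_into \<B>"
  have opB: "open (B n)" for n
    unfolding B_def using from_nat_into[OF \<open>\<B> \<noteq> {}\<close>] \<B>(2) topological_basis_open by blast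
  have exB: "\<exists>n. x \<in> B n \<and> B n \<subseteq> U" if "open U" "x \<in> U" for U x
    using topological_basisE[OF \<B>(2) that] from_nat_into_surj[OF \<B>(1)] unfolding B_def by metis
  define C where "C n = (\<Union>z \<in> {z. B n \<inter> {w. R w z} = {}}. {w. R w z})" for n
  define D where "D n = closure (C n)" for n
  have lower: "v \<in> C n" if "w \<in> C n" "R v w" for v w n
    using that trans unfolding C_def by blast
  have "C m \<subseteq> C n \<or> C n \<subseteq> C m" for m n
    using lower total by (meson subsetI)
  then have chain: "D m \<subseteq> D n \<or> D n \<subseteq> D m" for m n
    unfolding D_def by (meson closure_mono)
  have conv: "convex (D n)" for n
    unfolding D_def by (intro convex_closure convex_lower_set[OF tot qc]) (rule lower)
  \<comment> \<open>\<open>D n\<close> respects strict preference: if it missed \<open>x\<close>,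
    all of \<open>C n\<close> would lie in the closed lower set of \<open>x\<close>, hence so would
    \<open>D n\<close> and its point \<open>w\<close>.\<close>
  have down: "x \<in> D n" if "w \<in> D n" "\<not> R w x" for x w n
  proof (rule ccontr)
    assume "x \<notin> D n"
    then have "x \<notin> C n" unfolding D_def using closure_subset by blast
    then have "C n \<subseteq> {w. R w x}" using lower total by (metis mem_Collect_eq subsetI)
    moreover have "closed {w. R w x}" using lsc unfolding lower_semicontinuous_rel_def by blast
    ultimately have "D n \<subseteq> {w. R w x}" unfolding D_def by (rule closure_minimal)
    then show False using that by blast
  qed
  have sep: "\<exists>n. x \<in> D n \<and> y \<notin> D n" if "\<not> R y x" for x y
  proof -
    have "open (- {w. R w x})" using lsc unfolding lower_semicontinuous_rel_def by blast
    moreover have "y \<in> - {w. R w x}" using that by simp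
    \<comment> \<open>A basic set around \<open>y\<close> that misses the lower set of
      \<open>x\<close> places \<open>x\<close> in \<open>C n\<close>. Being open and disjoint from
      \<open>C n\<close>, it also misses the closure \<open>D n\<close>.\<close>
    ultimately obtain n where n: "y \<in> B n" "B n \<subseteq> - {w. R w x}" using exB by meson
    moreover have "R x x" using total by blast
    ultimately have "x \<in> C n" unfolding C_def by blast
    then have "x \<in> D n" unfolding D_def using closure_subset by blast
    moreover have "B n \<inter> D n = {}"
      unfolding D_def by (subst open_Int_closure_eq_empty[OF opB]) (auto simp: C_def)
    ultimately show ?thesis using n by blast
  qed
  show ?thesis
  proof (rule that)
    show "lower_semicontinuous (\<lambda>x. \<Sum>n. (1/2) ^ n * of_bool (x \<notin> D n))"
      by (rule lower_semicontinuous_suminf_closed) (simp add: D_def)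
    show "quasi_convex (\<lambda>x. \<Sum>n. (1/2) ^ n * of_bool (x \<notin> D n))"
      by (rule quasi_convex_suminf_chain[OF conv chain])
    show "(\<Sum>n. (1/2) ^ n * of_bool (x \<notin> D n)) < (\<Sum>n. (1/2) ^ n * of_bool (y \<notin> D n) :: real)"
      if lt: "\<not> R y x" for x y
    proof -
      obtain k where "x \<in> D k" "y \<notin> D k" using sep[OF lt] by blast
      then show ?thesis
        using down lt by (intro suminf_half_power_of_bool_strict_mono[where k = k]) auto
    qed
  qed
qed

theorem proposition2p18:
  fixes F :: "(real ^ 'n) multimap"
  assumes "full_domain F"
    and "cyclically_quasi_monotone F"
    and "total_rel (weak_rel F)"
  shows "preference_rel (weak_rel F)
    \<and> quasi_convex_rel (weak_rel F)
    \<and> lower_semicontinuous_rel (weak_rel F)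
    \<and> (\<exists>f :: real ^ 'n \<Rightarrow> real.
          lower_semicontinuous f \<and> quasi_convex f \<and> (\<forall>x. F x \<subseteq> normal_cone f x))"
proof (intro conjI quasi_convex_weak_rel lower_semicontinuous_weak_rel)
  show pref: "preference_rel (weak_rel F)"
    using assms(3) preorder_weak_rel unfolding preference_rel_def by blast
  obtain f :: "real ^ 'n \<Rightarrow> real" where f: "lower_semicontinuous f" "quasi_convex f"
    and mono: "\<And>x y. \<not> weak_rel F y x \<Longrightarrow> f x < f y"
    using quasi_convex_lower_semicontinuous_utility
      [OF pref quasi_convex_weak_rel lower_semicontinuous_weak_rel] by blast
  have "p \<bullet> (w - x) \<le> 0" if "p \<in> F x" "f w \<le> f x" for p w x
  proof (rule ccontr)
    assume "\<not> p \<bullet> (w - x) \<le> 0"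
    then have "(w - x) \<bullet> p > 0" by (simp add: inner_commute)
    then have "strict_rel F x w"
      using that(1) unfolding strict_rel_last_step[of F x w] by blast
    \<comment> \<open>Contraposing \<open>mono\<close> turns \<open>f w \<le> f x\<close> into a
      weak preference, which carries the one-link chain from \<open>x\<close> to \<open>w\<close>
      over to a chain from \<open>x\<close> back to \<open>x\<close>.\<close>
    moreover have "weak_rel F w x" using mono that(2) by (meson not_le)
    ultimately have "strict_rel F x x" unfolding weak_rel_def by blast
    then show False using strict_rel_irrefl[OF assms(2)] by blast
  qed
  then have "\<forall>x. F x \<subseteq> normal_cone f x" unfolding normal_cone_def by blast
  then show "\<exists>f :: real ^ 'n \<Rightarrow> real.
      lower_semicontinuous f \<and> quasi_convex f \<and> (\<forall>x. F x \<subseteq> normal_cone f x)"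
    using f by blast
qed

end
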